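(* For every integer $n \geq 3$, $R_2(c(nK_4)) = 13n-3$. Furthermore, if $R_2(2K_4) \leq 23$, then $R_2(c(2K_4)) = 23$.
   Context: For a positive integer $n$, $nK_4$ denotes the disjoint union of $n$ copies of the complete graph $K_4$. For a (disconnected) graph $H$, $c(H)$ denotes the set of all connected graphs containing $H$ as a subgraph. $R_2(c(H))$ is the least integer $N$ such that every $2$-edge-coloring of $K_N$ contains a monochromatic copy of some graph in $c(H)$. $R_2(2K_4)$ is the usual $2$-color Ramsey number of $2K_4$: the least $N$ such that every $2$-edge-coloring of $K_N$ contains a monochromatic copy of $2K_4$. *)

theory Defs
  imports "HOL-Library.Ramsey"
begin

record 'a ugraph =
  verts :: "'a set"
  edges :: "'a set set"

definition simple_graph :: "'a ugraph \<Rightarrow> bool" where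
  "simple_graph G \<longleftrightarrow> finite (verts G) \<and> edges G \<subseteq> [verts G]\<^bsup>2\<^esup>"

definition adj :: "'a ugraph \<Rightarrow> ('a \<times> 'a) set" where
  "adj G = {(u, v). {u, v} \<in> edges G}"

definition connected_graph :: "'a ugraph \<Rightarrow> bool" where
  "connected_graph G \<longleftrightarrow>
     verts G \<noteq> {} \<and> (\<forall>u \<in> verts G. \<forall>v \<in> verts G. (u, v) \<in> (adj G)\<^sup>*)"

definition subgraph :: "'a ugraph \<Rightarrow> 'a ugraph \<Rightarrow> bool" where
  "subgraph H G \<longleftrightarrow> verts H \<subseteq> verts G \<and> edges H \<subseteq> edges G"

definition relabel :: "('a \<Rightarrow> 'b) \<Rightarrow> 'a ugraph \<Rightarrow> 'b ugraph" where
  "relabel f G = \<lparr>verts = f ` verts G, edges = (\<lambda>e. f ` e) ` edges G\<rparr>"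

definition contains_copy :: "'b ugraph \<Rightarrow> 'a ugraph \<Rightarrow> bool" where
  "contains_copy G H \<longleftrightarrow> (\<exists>f. inj_on f (verts H) \<and> subgraph (relabel f H) G)"

definition complete_graph :: "nat \<Rightarrow> nat ugraph" where
  "complete_graph n = \<lparr>verts = {..<n}, edges = [{..<n}]\<^bsup>2\<^esup>\<rparr>"

definition copies :: "nat \<Rightarrow> 'a ugraph \<Rightarrow> (nat \<times> 'a) ugraph" where
  "copies n G = \<lparr>verts = {..<n} \<times> verts G,
                 edges = (\<Union>i<n. (\<lambda>e. Pair i ` e) ` edges G)\<rparr>"

text \<open>Every finite graph is isomorphic to one whose vertices are natural numbers, and
  containment of copies is invariant under isomorphism, so the class of all connected graphs
  containing \<open>H\<close> can be represented by graphs on natural numbers.\<close>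

definition connected_supergraphs :: "'a ugraph \<Rightarrow> nat ugraph set" where
  "connected_supergraphs H = {G. simple_graph G \<and> connected_graph G \<and> contains_copy G H}"

definition edge_coloring :: "nat \<Rightarrow> 'a ugraph \<Rightarrow> ('a set \<Rightarrow> nat) \<Rightarrow> bool" where
  "edge_coloring r G c \<longleftrightarrow> (\<forall>e \<in> edges G. c e < r)"

definition color_class :: "'a ugraph \<Rightarrow> ('a set \<Rightarrow> nat) \<Rightarrow> nat \<Rightarrow> 'a ugraph" where
  "color_class G c i = \<lparr>verts = verts G, edges = {e \<in> edges G. c e = i}\<rparr>"

definition mono_copy :: "nat \<Rightarrow> 'b ugraph \<Rightarrow> ('b set \<Rightarrow> nat) \<Rightarrow> 'a ugraph \<Rightarrow> bool" where
  "mono_copy r G c H \<longleftrightarrow> (\<exists>i<r. contains_copy (color_class G c i) H)"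

text \<open>The least element is taken over a set that is nonempty, by Ramsey's theorem, whenever the
  family has a finite simple member and \<open>r > 0\<close>.\<close>

definition ramsey_number :: "nat \<Rightarrow> 'a ugraph set \<Rightarrow> nat" where
  "ramsey_number r F =
     (LEAST N. \<forall>c. edge_coloring r (complete_graph N) c \<longrightarrow>
        (\<exists>H \<in> F. mono_copy r (complete_graph N) c H))"

end

theory Submission
  imports Defs "HOL-Library.Disjoint_Sets"
begin

text \<open>Since \<open>R(K\<^sub>4) \<le> 18\<close>, greedy extraction yields \<open>n\<close> disjoint monochromatic \<open>K\<^sub>4\<close> of one colour,
  say red, when \<open>n \<ge> 3\<close>; for \<open>n = 2\<close> this is the hypothesis on \<open>R\<^sub>2(2K\<^sub>4)\<close>. If the red graph is disconnected, the blue graph is connected, all edges between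
  different red components are blue, and it suffices to find \<open>n\<close> disjoint blue \<open>K\<^sub>4\<close> when no red
  component has \<open>n\<close> disjoint red ones. A set without \<open>n\<close> disjoint red \<open>K\<^sub>4\<close> that has \<open>4n - 1 + y\<close>
  vertices, where \<open>y \<le> n\<close>, contains \<open>y\<close> disjoint blue edges. If three unions of red components have
  at least \<open>n\<close> vertices each, these edges and the vertices outside the three sets extend to enough
  blue \<open>K\<^sub>4\<close>. Otherwise two such unions cover all but fewer than \<open>n\<close> vertices; either both contain
  \<open>n\<close> disjoint blue edges, or one is so large that it contains about \<open>n\<close> disjoint blue triangles,
  each of which is completed by a vertex outside.\<close>

subsection \<open>Small Ramsey numbers\<close>

definition arrows :: "'a set set \<Rightarrow> nat \<Rightarrow> nat \<Rightarrow> nat \<Rightarrow> bool" where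
  "arrows E N a b \<longleftrightarrow> (\<forall>V. finite V \<longrightarrow> N \<le> card V \<longrightarrow>
     (\<exists>S\<subseteq>V. card S = a \<and> clique S E \<or> card S = b \<and> clique S (- E)))"

lemma arrowsD:
  assumes "arrows E N a b" "finite V" "N \<le> card V"
  obtains S where "S \<subseteq> V" "card S = a" "clique S E" | S where "S \<subseteq> V" "card S = b" "clique S (- E)"
  using assms unfolding arrows_def by blast

lemma arrows_Compl: "arrows E N a b \<Longrightarrow> arrows (- E) N b a"
  unfolding arrows_def double_complement by blast

lemma clique_insert:
  "clique S E \<Longrightarrow> (\<And>x. x \<in> S \<Longrightarrow> {v, x} \<in> E) \<Longrightarrow> clique (insert v S) E"
  unfolding clique_def by (metis insert_commute insert_iff)

lemma clique_doubleton: "{x, y} \<in> E \<Longrightarrow> clique {x, y} E"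
  by (auto simp: clique_def insert_commute)

lemma arrows_edge: "arrows E b 2 b"
  unfolding arrows_def
proof (intro allI impI)
  fix V :: "'a set"
  assume V: "finite V" "b \<le> card V"
  show "\<exists>S\<subseteq>V. card S = 2 \<and> clique S E \<or> card S = b \<and> clique S (- E)"
  proof (cases "clique V (- E)")
    case True
    obtain S where "S \<subseteq> V" "card S = b" using V by (meson obtain_subset_with_card_n)
    then show ?thesis using True smaller_clique by blast
  next
    case False
    then obtain x y where xy: "x \<in> V" "y \<in> V" "x \<noteq> y" "{x, y} \<in> E" by (auto simp: clique_def)
    then show ?thesis by (intro exI[of _ "{x, y}"]) (auto simp: clique_doubleton)
  qed
qed

lemma neighbourhood_arrows:
  assumes "arrows E M a b" "finite V" "v \<in> V" "M \<le> card {w \<in> V - {v}. {v, w} \<in> E}"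
  shows "\<exists>S\<subseteq>V. card S = Suc a \<and> clique S E \<or> card S = b \<and> clique S (- E)"
proof -
  let ?R = "{w \<in> V - {v}. {v, w} \<in> E}"
  have fR: "finite ?R" using assms by auto
  from assms(1) fR assms(4) show ?thesis
  proof (cases rule: arrowsD)
    case (1 S)
    have "finite S" using 1(1) fR finite_subset by blast
    moreover have "v \<notin> S" using 1(1) by blast
    ultimately have "card (insert v S) = Suc a" using 1(2) by simp
    moreover have "clique (insert v S) E" using 1 by (intro clique_insert) auto
    ultimately show ?thesis using 1(1) assms(3) by (intro exI[of _ "insert v S"]) auto
  next
    case (2 S)
    then show ?thesis by (intro exI[of _ S]) auto
  qed
qed

lemma card_neighbourhoods:
  assumes "finite V" "v \<in> V"
  shows "Suc (card {w \<in> V - {v}. {v, w} \<in> E} + card {w \<in> V - {v}. {v, w} \<in> - E}) = card V"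
proof -
  have "card {w \<in> V - {v}. {v, w} \<in> E} + card {w \<in> V - {v}. {v, w} \<in> - E}
      = card ({w \<in> V - {v}. {v, w} \<in> E} \<union> {w \<in> V - {v}. {v, w} \<in> - E})"
    using assms by (intro card_Un_disjoint[symmetric]) auto
  also have "{w \<in> V - {v}. {v, w} \<in> E} \<union> {w \<in> V - {v}. {v, w} \<in> - E} = V - {v}" by auto
  finally show ?thesis using assms by (metis card_Suc_Diff1)
qed

lemma arrows_step:
  assumes "arrows E M a (Suc b)" "arrows E N (Suc a) b" "0 < M"
  shows "arrows E (M + N) (Suc a) (Suc b)"
  unfolding arrows_def
proof (intro allI impI)
  fix V :: "'a set"
  assume V: "finite V" "M + N \<le> card V"
  then obtain v where v: "v \<in> V" using assms(3) by fastforce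
  consider "M \<le> card {w \<in> V - {v}. {v, w} \<in> E}" | "N \<le> card {w \<in> V - {v}. {v, w} \<in> - E}"
    using card_neighbourhoods[OF V(1) v, of E] V(2) by linarith
  then show "\<exists>S\<subseteq>V. card S = Suc a \<and> clique S E \<or> card S = Suc b \<and> clique S (- E)"
  proof cases
    case 1
    then show ?thesis using neighbourhood_arrows[OF assms(1) V(1) v] by blast
  next
    case 2
    then show ?thesis
      using neighbourhood_arrows[OF arrows_Compl[OF assms(2)] V(1) v] unfolding double_complement by blast
  qed
qed

lemma arrows_3_3: "arrows E 6 3 3"
proof -
  have "arrows E 3 2 (Suc 2)" "arrows E 3 (Suc 2) 2"
    using arrows_edge[of E 3] arrows_Compl[OF arrows_edge[of "- E" 3]] by simp_all
  then have "arrows E (3 + 3) (Suc 2) (Suc 2)" by (rule arrows_step) simp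
  then show ?thesis by simp
qed

lemma even_sum_degrees:
  assumes "finite V"
  shows "even (\<Sum>v\<in>V. card {w \<in> V - {v}. {v, w} \<in> E})"
proof -
  let ?F = "{e \<in> [V]\<^bsup>2\<^esup>. e \<in> E}"
  have fF: "finite ?F" using assms by (simp add: finite_imp_finite_nsets)
  have deg: "card {e \<in> ?F. v \<in> e} = card {w \<in> V - {v}. {v, w} \<in> E}" if "v \<in> V" for v
  proof -
    have "bij_betw (\<lambda>w. {v, w}) {w \<in> V - {v}. {v, w} \<in> E} {e \<in> ?F. v \<in> e}"
      unfolding bij_betw_def
    proof
      show "inj_on (\<lambda>w. {v, w}) {w \<in> V - {v}. {v, w} \<in> E}"
        by (auto simp: inj_on_def doubleton_eq_iff)
      show "(\<lambda>w. {v, w}) ` {w \<in> V - {v}. {v, w} \<in> E} = {e \<in> ?F. v \<in> e}"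
      proof (intro equalityI subsetI)
        fix e assume "e \<in> (\<lambda>w. {v, w}) ` {w \<in> V - {v}. {v, w} \<in> E}"
        then show "e \<in> {e \<in> ?F. v \<in> e}" using that by auto
      next
        fix e assume e: "e \<in> {e \<in> ?F. v \<in> e}"
        then obtain x y where "e = {x, y}" "x \<in> V" "y \<in> V" "x \<noteq> y"
          unfolding mem_Collect_eq by (metis nsets2_E)
        then show "e \<in> (\<lambda>w. {v, w}) ` {w \<in> V - {v}. {v, w} \<in> E}"
          using e by (auto simp: insert_commute)
      qed
    qed
    then show ?thesis by (rule bij_betw_same_card[symmetric])
  qed
  have "(\<Sum>v\<in>V. card {e \<in> ?F. v \<in> e}) = (\<Sum>e\<in>?F. 2)"
  proof (rule sum_multicount_gen[OF assms fF], intro ballI)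
    fix e assume "e \<in> ?F"
    then have "e \<subseteq> V" "card e = 2" by (auto simp: nsets_def)
    then show "card {i \<in> V. i \<in> e} = 2" by (simp add: Collect_conj_eq Int_absorb1)
  qed
  then show ?thesis using deg by simp
qed

text \<open>In a colouring of nine vertices without the two cliques every vertex has degree exactly three
  in the first colour, which is impossible by parity.\<close>

lemma arrows_3_4: "arrows E 9 3 4"
  unfolding arrows_def
proof (intro allI impI)
  fix V :: "'a set"
  assume "finite V" "9 \<le> card V"
  then obtain U where U: "U \<subseteq> V" "card U = 9" "finite U"
    by (meson obtain_subset_with_card_n)
  show "\<exists>S\<subseteq>V. card S = 3 \<and> clique S E \<or> card S = 4 \<and> clique S (- E)"
  proof (rule ccontr)
    assume "\<not> ?thesis"
    then have no: "\<not> (\<exists>S\<subseteq>U. card S = 3 \<and> clique S E \<or> card S = 4 \<and> clique S (- E))"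
      using U(1) by blast
    have "card {w \<in> U - {v}. {v, w} \<in> E} = 3" if v: "v \<in> U" for v
    proof -
      have "\<not> 4 \<le> card {w \<in> U - {v}. {v, w} \<in> E}"
        using neighbourhood_arrows[OF arrows_edge U(3) v, of 4 E] no by (auto simp: numeral_3_eq_3)
      moreover have "\<not> 6 \<le> card {w \<in> U - {v}. {v, w} \<in> - E}"
        using neighbourhood_arrows[OF arrows_3_3 U(3) v, of "- E"] no by auto
      ultimately show ?thesis using card_neighbourhoods[OF U(3) v, of E] U(2) by linarith
    qed
    then have "(\<Sum>v\<in>U. card {w \<in> U - {v}. {v, w} \<in> E}) = 27" using U(2) by simp
    then show False using even_sum_degrees[OF U(3), of E] by simp
  qed
qed

lemma arrows_4_3: "arrows E 9 4 3"
  using arrows_Compl[OF arrows_3_4, of "- E"] by simp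

lemma arrows_4_4: "arrows E 18 4 4"
proof -
  have "arrows E (9 + 9) (Suc 3) (Suc 3)"
    using arrows_3_4 arrows_4_3 by (intro arrows_step) simp_all
  then show ?thesis by simp
qed

subsection \<open>Packings of disjoint cliques\<close>

definition packing :: "'a set set \<Rightarrow> 'a set \<Rightarrow> nat set \<Rightarrow> (nat \<Rightarrow> nat) \<Rightarrow> bool" where
  "packing E X I f \<longleftrightarrow> (\<exists>K. (\<forall>i\<in>I. K i \<subseteq> X \<and> card (K i) = f i \<and> clique (K i) E) \<and>
     disjoint_family_on K I)"

lemma packing_empty [simp]: "packing E X {} f"
  by (auto simp: packing_def disjoint_family_on_def)

lemma packing_mono:
  assumes "packing E X I f" "X \<subseteq> Y" "J \<subseteq> I" "\<And>i. i \<in> J \<Longrightarrow> f i = g i"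
  shows "packing E Y J g"
  using assms unfolding packing_def disjoint_family_on_def by (smt (verit) subset_eq)

lemma packing_reindex:
  assumes "packing E X I (\<lambda>_. q)" "finite J" "finite I" "card J \<le> card I"
  shows "packing E X J (\<lambda>_. q)"
proof -
  obtain K where K: "\<And>i. i \<in> I \<Longrightarrow> K i \<subseteq> X \<and> card (K i) = q \<and> clique (K i) E"
    "disjoint_family_on K I"
    using assms(1) unfolding packing_def by blast
  obtain h where h: "h ` J \<subseteq> I" "inj_on h J" using assms card_le_inj by blast
  have "disjoint_family_on (K \<circ> h) J"
    unfolding disjoint_family_on_def
  proof (intro ballI impI)
    fix m n assume "m \<in> J" "n \<in> J" "m \<noteq> n"
    then show "(K \<circ> h) m \<inter> (K \<circ> h) n = {}"
      using h K(2) by (auto dest: inj_onD dest!: disjoint_family_onD[of K I "h m" "h n"])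
  qed
  then show ?thesis using K(1) h(1) unfolding packing_def by (intro exI[of _ "K \<circ> h"]) auto
qed

lemma packing_join:
  assumes "packing E X I f" "packing E Y I g" "X \<inter> Y = {}" "finite X" "finite Y"
    and xy: "\<And>x y. x \<in> X \<Longrightarrow> y \<in> Y \<Longrightarrow> {x, y} \<in> E"
  shows "packing E (X \<union> Y) I (\<lambda>i. f i + g i)"
proof -
  obtain K where K: "\<And>i. i \<in> I \<Longrightarrow> K i \<subseteq> X \<and> card (K i) = f i \<and> clique (K i) E"
    "disjoint_family_on K I"
    using assms(1) unfolding packing_def by blast
  obtain L where L: "\<And>i. i \<in> I \<Longrightarrow> L i \<subseteq> Y \<and> card (L i) = g i \<and> clique (L i) E"
    "disjoint_family_on L I"
    using assms(2) unfolding packing_def by blast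
  have "K i \<union> L i \<subseteq> X \<union> Y \<and> card (K i \<union> L i) = f i + g i \<and> clique (K i \<union> L i) E" if i: "i \<in> I" for i
  proof (intro conjI)
    show "K i \<union> L i \<subseteq> X \<union> Y" using K L i by blast
    have "K i \<inter> L i = {}" "finite (K i)" "finite (L i)"
      using K(1)[OF i] L(1)[OF i] assms(3-5) finite_subset by blast+
    then show "card (K i \<union> L i) = f i + g i" using K(1)[OF i] L(1)[OF i] by (simp add: card_Un_disjoint)
    show "clique (K i \<union> L i) E" using K(1)[OF i] L(1)[OF i] xy by (intro clique_Un) blast+
  qed
  moreover have "disjoint_family_on (\<lambda>i. K i \<union> L i) I"
    unfolding disjoint_family_on_def
  proof (intro ballI impI)
    fix m n assume mn: "m \<in> I" "n \<in> I" "m \<noteq> n"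
    have "K m \<inter> K n = {}" "L m \<inter> L n = {}"
      using mn K(2) L(2) by (auto simp: disjoint_family_on_def)
    then show "(K m \<union> L m) \<inter> (K n \<union> L n) = {}"
      using K(1)[OF mn(1)] K(1)[OF mn(2)] L(1)[OF mn(1)] L(1)[OF mn(2)] assms(3) by blast
  qed
  ultimately show ?thesis unfolding packing_def by (intro exI[of _ "\<lambda>i. K i \<union> L i"]) blast
qed

lemma packing_Un:
  assumes "packing E X I f" "packing E Y J f" "X \<inter> Y = {}"
  shows "packing E (X \<union> Y) (I \<union> J) f"
proof -
  obtain K where K: "\<And>i. i \<in> I \<Longrightarrow> K i \<subseteq> X \<and> card (K i) = f i \<and> clique (K i) E"
    "disjoint_family_on K I"
    using assms(1) unfolding packing_def by blast
  obtain L where L: "\<And>i. i \<in> J \<Longrightarrow> L i \<subseteq> Y \<and> card (L i) = f i \<and> clique (L i) E"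
    "disjoint_family_on L J"
    using assms(2) unfolding packing_def by blast
  let ?M = "\<lambda>i. if i \<in> I then K i else L i"
  have "disjoint_family_on ?M (I \<union> J)"
    unfolding disjoint_family_on_def
  proof (intro ballI impI)
    fix m n assume mn: "m \<in> I \<union> J" "n \<in> I \<union> J" "m \<noteq> n"
    show "?M m \<inter> ?M n = {}"
      using mn K(1)[of m] K(1)[of n] L(1)[of m] L(1)[of n] assms(3)
        disjoint_family_onD[OF K(2), of m n] disjoint_family_onD[OF L(2), of m n]
      by (cases "m \<in> I"; cases "n \<in> I") (simp_all, blast+)
  qed
  moreover have "\<forall>i\<in>I \<union> J. ?M i \<subseteq> X \<union> Y \<and> card (?M i) = f i \<and> clique (?M i) E"
    using K(1) L(1) by auto
  ultimately show ?thesis unfolding packing_def by (intro exI[of _ ?M]) blast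
qed

lemma packing_insert:
  assumes "packing E X I f" "finite X" "finite I" "sum f I + t \<le> card X" 
    and t: "\<And>Y. Y \<subseteq> X \<Longrightarrow> t \<le> card Y \<Longrightarrow> \<exists>S\<subseteq>Y. card S = f i \<and> clique S E"
  shows "packing E X (insert i I) f"
proof (cases "i \<in> I")
  case True
  then show ?thesis using assms(1) by (simp add: insert_absorb)
next
  case False
  obtain K where K: "\<And>i. i \<in> I \<Longrightarrow> K i \<subseteq> X \<and> card (K i) = f i \<and> clique (K i) E"
    "disjoint_family_on K I"
    using assms(1) unfolding packing_def by blast
  let ?U = "\<Union>j\<in>I. K j"
  have U: "?U \<subseteq> X" using K(1) by blast
  have "card ?U \<le> sum f I"
    using card_UN_le[OF assms(3), of K] K(1) by simp
  then have "t \<le> card (X - ?U)"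
    using assms(2,4) U by (simp add: card_Diff_subset finite_subset)
  then obtain S where S: "S \<subseteq> X - ?U" "card S = f i" "clique S E"
    using t[of "X - ?U"] by blast
  let ?K = "K(i := S)"
  have "disjoint_family_on ?K I"
    using K(2) False unfolding disjoint_family_on_def by auto
  moreover have "(\<Union>j\<in>I. ?K j) = ?U" using False by auto
  ultimately have "disjoint_family_on ?K (insert i I)"
    using False S(1) by (subst disjoint_family_on_insert) auto
  moreover have "\<forall>j\<in>insert i I. ?K j \<subseteq> X \<and> card (?K j) = f j \<and> clique (?K j) E"
    using K(1) S by auto
  ultimately show ?thesis unfolding packing_def by (intro exI[of _ ?K]) blast
qed

lemma packing_extend:
  assumes "finite J" "packing E X I f" "finite X" "finite I" "I \<inter> J = {}"
    and "\<And>j. j \<in> J \<Longrightarrow> f j = q"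
    and "sum f I + q * card J + t \<le> card X + q"
    and t: "\<And>Y. Y \<subseteq> X \<Longrightarrow> t \<le> card Y \<Longrightarrow> \<exists>S\<subseteq>Y. card S = q \<and> clique S E"
  shows "packing E X (I \<union> J) f"
  using assms(1,5-7)
proof (induction J rule: finite_induct)
  case empty
  then show ?case using assms(2) by simp
next
  case (insert j J)
  have "packing E X (insert j (I \<union> J)) f"
  proof (rule packing_insert)
    show "packing E X (I \<union> J) f" using insert by (intro insert.IH) auto
    have "sum f (I \<union> J) = sum f I + sum f J"
      using insert assms(4) by (intro sum.union_disjoint) auto
    also have "sum f J = q * card J" using insert by simp
    finally show "sum f (I \<union> J) + t \<le> card X" using insert by simp
    show "\<exists>S\<subseteq>Y. card S = f j \<and> clique S E" if "Y \<subseteq> X" "t \<le> card Y" for Y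
      using t that insert by auto
  qed (use insert assms in auto)
  then show ?case by simp
qed

lemma packing_singletons:
  assumes "packing E X I f" "finite X" "finite I" "finite J" "I \<inter> J = {}"
    and "\<And>j. j \<in> J \<Longrightarrow> f j = 1" "sum f I + card J \<le> card X"
  shows "packing E X (I \<union> J) f"
proof (rule packing_extend[where q = 1 and t = 1])
  fix Y :: "'a set" assume "1 \<le> card Y"
  then obtain y where "y \<in> Y" by fastforce
  then show "\<exists>S\<subseteq>Y. card S = 1 \<and> clique S E" by (intro exI[of _ "{y}"]) (auto simp: clique_def)
qed (use assms in auto)

lemma obtain_clique_free_rest:
  assumes "\<not> packing E X {..<n} (\<lambda>_. q)" "finite X" "0 < n"
  obtains Y where "Y \<subseteq> X" "card X \<le> card Y + q * (n - 1)" "\<not> (\<exists>S\<subseteq>Y. card S = q \<and> clique S E)"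
proof -
  have "\<exists>Y\<subseteq>X. card X \<le> card Y + q * (n - 1) \<and> \<not> (\<exists>S\<subseteq>Y. card S = q \<and> clique S E)"
  proof (rule ccontr)
    assume no: "\<not> ?thesis"
    have c: "q * (n - 1) \<le> card X"
    proof (rule ccontr)
      assume "\<not> ?thesis"
      moreover from this have "q \<noteq> 0" by (metis le0 mult_0)
      moreover have "\<exists>S\<subseteq>{}. card S = q \<and> clique S E"
        using no calculation(1) by (metis add_0 card.empty empty_subsetI nat_le_linear)
      ultimately show False by auto
    qed
    have "packing E X ({} \<union> {..<n}) (\<lambda>_. q)"
    proof (rule packing_extend[where t = "card X - q * (n - 1)" and q = q])
      show "sum (\<lambda>_. q) {} + q * card {..<n} + (card X - q * (n - 1)) \<le> card X + q"
        using c assms(3) by (cases n) auto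
      show "\<exists>S\<subseteq>Y. card S = q \<and> clique S E" if "Y \<subseteq> X" "card X - q * (n - 1) \<le> card Y" for Y
        using no that by (meson le_diff_conv)
    qed (use assms in auto)
    then show False using assms(1) by simp
  qed
  then show thesis using that by blast
qed

lemma not_packing_small:
  assumes "finite X" "card X < q * n"
  shows "\<not> packing E X {..<n} (\<lambda>_. q)"
proof
  assume "packing E X {..<n} (\<lambda>_. q)"
  then obtain K where K: "\<And>i. i < n \<Longrightarrow> K i \<subseteq> X \<and> card (K i) = q" "disjoint_family_on K {..<n}"
    unfolding packing_def by auto
  have fin: "finite (K i)" if "i < n" for i using K(1)[OF that] assms(1) finite_subset by blast
  have "card (\<Union>i<n. K i) = (\<Sum>i<n. card (K i))"
    using K(2) fin by (intro card_UN_disjoint) (auto simp: disjoint_family_on_def)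
  also have "\<dots> = q * n" using K(1) by simp
  moreover have "(\<Union>i<n. K i) \<subseteq> X" using K(1) by blast
  ultimately show False using assms card_mono[of X "\<Union>i<n. K i"] by simp
qed

lemma packing_extend_free:
  assumes "arrows E t 4 q" "\<not> (\<exists>S\<subseteq>X. card S = 4 \<and> clique S E)"
    and "packing (- E) X I f" "finite X" "finite I" "finite J" "I \<inter> J = {}"
    and "\<And>j. j \<in> J \<Longrightarrow> f j = q"
    and "sum f I + q * card J + t \<le> card X + q"
  shows "packing (- E) X (I \<union> J) f"
proof (rule packing_extend[where q = q and t = t])
  fix Y assume Y: "Y \<subseteq> X" "t \<le> card Y"
  then have "finite Y" using assms(4) finite_subset by blast
  from assms(1) this Y(2) show "\<exists>S\<subseteq>Y. card S = q \<and> clique S (- E)"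
    by (cases rule: arrowsD) (use assms(2) Y(1) in blast)+
qed (use assms in auto)

lemma mono_packing:
  assumes "finite V" "8 * n + 10 \<le> card V" "0 < n"
  shows "packing E V {..<n} (\<lambda>_. 4) \<or> packing (- E) V {..<n} (\<lambda>_. 4)"
proof (cases "packing E V {..<n} (\<lambda>_. 4)")
  case False
  obtain Y where Y: "Y \<subseteq> V" "card V \<le> card Y + 4 * (n - 1)" "\<not> (\<exists>S\<subseteq>Y. card S = 4 \<and> clique S E)"
    using obtain_clique_free_rest[OF False assms(1,3)] by blast
  have "packing (- E) Y ({} \<union> {..<n}) (\<lambda>_. 4)"
    using Y assms finite_subset[OF Y(1)]
    by (intro packing_extend_free[OF arrows_4_4 Y(3)]) auto
  then show ?thesis using packing_mono[of "- E" Y "{..<n}" "\<lambda>_. 4" V "{..<n}" "\<lambda>_. 4"] Y(1) by simp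
qed auto

lemma obtain_disjoint_triples:
  assumes "finite R" "3 * s < card R"
  shows "\<exists>T. (\<forall>i<s. T i \<subseteq> R - {z i} \<and> card (T i) = (3::nat)) \<and> disjoint_family_on T {..<s::nat}"
  using assms(2)
proof (induction s)
  case 0
  then show ?case by (auto simp: disjoint_family_on_def)
next
  case (Suc s)
  then obtain T where T: "\<And>i. i < s \<Longrightarrow> T i \<subseteq> R - {z i} \<and> card (T i) = 3" "disjoint_family_on T {..<s}"
    by auto
  let ?U = "\<Union>i<s. T i"
  have U: "?U \<subseteq> R" using T(1) by blast
  have "card ?U \<le> (\<Sum>i<s. card (T i))" by (rule card_UN_le) simp
  also have "\<dots> = 3 * s" using T(1) by simp
  finally have cU: "card (insert (z s) ?U) \<le> 3 * s + 1"
    using assms(1) finite_subset[OF U] by (simp add: card_insert_if)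
  have "card R - card (insert (z s) ?U) \<le> card (R - insert (z s) ?U)"
    using assms(1) finite_subset[OF U] by (intro diff_card_le_card_Diff) simp
  then have "3 \<le> card (R - insert (z s) ?U)" using cU Suc.prems by simp
  then obtain S where S: "S \<subseteq> R - insert (z s) ?U" "card S = 3" by (meson obtain_subset_with_card_n)
  let ?T = "T(s := S)"
  have "disjoint_family_on ?T {..<s}"
    using T(2) unfolding disjoint_family_on_def by auto
  moreover have "(\<Union>i<s. ?T i) = ?U" by auto
  ultimately have "disjoint_family_on ?T (insert s {..<s})"
    using S(1) by (subst disjoint_family_on_insert) auto
  moreover have "\<forall>i<Suc s. ?T i \<subseteq> R - {z i} \<and> card (?T i) = 3"
    using T(1) S by (auto simp: less_Suc_eq)
  ultimately show ?case by (intro exI[of _ ?T]) (simp only: lessThan_Suc simp_thms)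
qed

text \<open>Take a maximum blue matching. The vertices it misses form a red clique, and since the matching
  cannot be augmented, each of its edges has an end that is joined in red to all but at most one of
  them. Three missed vertices complete such an end to a red \<open>K\<^sub>4\<close>, so a matching that is too small
  would leave room for \<open>n\<close> disjoint red \<open>K\<^sub>4\<close>.\<close>

lemma blue_matching:
  assumes fin: "finite X" and no: "\<not> packing E X {..<n} (\<lambda>_. 4)"
    and y: "y \<le> n" "4 * n + y \<le> card X + 1"
  shows "packing (- E) X {..<y} (\<lambda>_. 2)"
proof (rule ccontr)
  assume "\<not> ?thesis"
  then obtain s where s: "s < y" "packing (- E) X {..<s} (\<lambda>_. 2)" "\<not> packing (- E) X {..<Suc s} (\<lambda>_. 2)"
    using ex_least_nat_less[of "\<lambda>s. \<not> packing (- E) X {..<s} (\<lambda>_. 2)" y] by auto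
  obtain K where K: "\<And>i. i < s \<Longrightarrow> K i \<subseteq> X \<and> card (K i) = 2 \<and> clique (K i) (- E)"
    "disjoint_family_on K {..<s}"
    using s(2) unfolding packing_def by auto
  have KK: "K i \<inter> K j = {}" if "i < s" "j < s" "i \<noteq> j" for i j
    using K(2) that by (auto simp: disjoint_family_on_def)
  let ?U = "\<Union>i<s. K i"
  define R where "R = X - ?U"
  have U: "?U \<subseteq> X" using K(1) by blast
  have "card ?U \<le> (\<Sum>i<s. card (K i))" by (rule card_UN_le) simp
  also have "\<dots> = 2 * s" using K(1) by simp
  finally have cR: "4 * n \<le> card R + s"
    unfolding R_def using fin U y s(1) by (simp add: card_Diff_subset finite_subset)
  have finR: "finite R" and RX: "R \<subseteq> X" using fin R_def by auto
  have KR: "K i \<inter> R = {}" if "i < s" for i using that R_def by auto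
  have redR: "clique R E"
    unfolding clique_def
  proof (intro ballI impI, rule ccontr)
    fix a b assume ab: "a \<in> R" "b \<in> R" "a \<noteq> b" "{a, b} \<notin> E"
    let ?K = "K(s := {a, b})"
    have "disjoint_family_on ?K {..<s}"
      using K(2) unfolding disjoint_family_on_def by auto
    moreover have "(\<Union>i<s. ?K i) = ?U" by auto
    ultimately have "disjoint_family_on ?K (insert s {..<s})"
      using ab unfolding R_def by (subst disjoint_family_on_insert) auto
    moreover have "\<forall>i<Suc s. ?K i \<subseteq> X \<and> card (?K i) = 2 \<and> clique (?K i) (- E)"
      using K(1) ab RX by (auto simp: less_Suc_eq clique_doubleton)
    ultimately show False
      using s(3) unfolding packing_def lessThan_Suc[symmetric] by (metis lessThan_iff)
  qed
  have "\<exists>w z. w \<in> K i \<and> (\<forall>x\<in>R - {z}. {w, x} \<in> E)" if i: "i < s" for i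
  proof -
    obtain u v where uv: "K i = {u, v}" "u \<noteq> v" using K(1)[OF i] by (meson card_2_iff)
    show ?thesis
    proof (cases "\<forall>x\<in>R. {u, x} \<in> E")
      case True
      then show ?thesis using uv by blast
    next
      case False
      then obtain x where x: "x \<in> R" "{u, x} \<notin> E" by blast
      have "{v, y} \<in> E" if y: "y \<in> R - {x}" for y
      proof (rule ccontr)
        assume yE: "{v, y} \<notin> E"
        have uvR: "u \<notin> R" "v \<notin> R" "u \<in> X" "v \<in> X" using KR[OF i] K(1)[OF i] uv by auto
        let ?K = "K(i := {u, x}, s := {v, y})"
        have "?K j \<inter> ?K k = {}" if "j < Suc s" "k < Suc s" "j < k \<or> k < j" for j k
        proof -
          have *: "K j \<inter> {u, v, x, y} = {}" if "j < s" "j \<noteq> i" for j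
            using KK[OF that(1) i that(2)] KR[OF that(1)] uv(1) x(1) y by blast
          have **: "{u, x} \<inter> {v, y} = {}" using uv(2) uvR x(1) y by auto
          show ?thesis
            using *[of j] *[of k] ** KK[of j k] that i by (auto simp: less_Suc_eq)
        qed
        then have "disjoint_family_on ?K {..<Suc s}"
          unfolding disjoint_family_on_def by (metis lessThan_iff linorder_neqE_nat)
        moreover have "\<forall>j<Suc s. ?K j \<subseteq> X \<and> card (?K j) = 2 \<and> clique (?K j) (- E)"
        proof (intro allI impI)
          fix j assume j: "j < Suc s"
          have "u \<noteq> x" "v \<noteq> y" using uvR x(1) y by auto
          then show "?K j \<subseteq> X \<and> card (?K j) = 2 \<and> clique (?K j) (- E)"
            using K(1)[of j] j x y yE uvR RX by (auto simp: less_Suc_eq clique_doubleton)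
        qed
        ultimately show False using s(3) unfolding packing_def by (metis lessThan_iff)
      qed
      then show ?thesis using uv by blast
    qed
  qed
  then obtain w z where wz: "\<And>i. i < s \<Longrightarrow> w i \<in> K i" "\<And>i x. i < s \<Longrightarrow> x \<in> R - {z i} \<Longrightarrow> {w i, x} \<in> E"
    by metis
  have "3 * s < card R" using cR s(1) y(1) by linarith
  then obtain T where T: "\<And>i. i < s \<Longrightarrow> T i \<subseteq> R - {z i} \<and> card (T i) = 3" "disjoint_family_on T {..<s}"
    using obtain_disjoint_triples[OF finR, of s z] by blast
  let ?Q = "\<Union>i<s. T i"
  have finT: "finite (T i)" if "i < s" for i
    using T(1)[OF that] finR finite_subset by (metis Diff_subset subset_trans)
  have wR: "w i \<notin> R" if "i < s" for i using wz(1)[OF that] KR[OF that] by blast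
  have "packing E (w ` {..<s} \<union> ?Q) {..<s} (\<lambda>_. 4)"
    unfolding packing_def
  proof (intro exI[of _ "\<lambda>i. insert (w i) (T i)"] conjI ballI)
    fix i assume "i \<in> {..<s}"
    then have i: "i < s" by simp
    show "insert (w i) (T i) \<subseteq> w ` {..<s} \<union> ?Q" using i by auto
    show "card (insert (w i) (T i)) = 4"
      using T(1)[OF i] finT[OF i] wR[OF i] by (subst card_insert_disjoint) auto
    have "clique (T i) E" using redR T(1)[OF i] by (meson Diff_subset smaller_clique subset_trans)
    then show "clique (insert (w i) (T i)) E"
      using T(1)[OF i] wz(2)[OF i] by (intro clique_insert) auto
  next
    show "disjoint_family_on (\<lambda>i. insert (w i) (T i)) {..<s}"
      unfolding disjoint_family_on_def
    proof (intro ballI impI)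
      fix i j assume "i \<in> {..<s}" "j \<in> {..<s}" and ij: "i \<noteq> j"
      then have i: "i < s" and j: "j < s" by auto
      have "w i \<noteq> w j" using wz(1)[OF i] wz(1)[OF j] KK[OF i j ij] by auto
      moreover have "T i \<inter> T j = {}" using T(2) i j ij by (auto simp: disjoint_family_on_def)
      ultimately show "insert (w i) (T i) \<inter> insert (w j) (T j) = {}"
        using wR[OF i] wR[OF j] T(1)[OF i] T(1)[OF j] by blast
    qed
  qed
  moreover have "packing E (R - ?Q) ({} \<union> {s..<n}) (\<lambda>_. 4)"
  proof (rule packing_extend[where t = 4 and q = 4])
    have "card ?Q \<le> (\<Sum>i<s. card (T i))" by (rule card_UN_le) simp
    also have "\<dots> = 3 * s" using T(1) by simp
    finally have "card R \<le> card (R - ?Q) + 3 * s"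
      using diff_card_le_card_Diff[of ?Q R] finT by simp
    then show "sum (\<lambda>_. 4) {} + 4 * card {s..<n} + 4 \<le> card (R - ?Q) + 4"
      using cR s(1) y(1) by simp
    fix Y assume Y: "Y \<subseteq> R - ?Q" "4 \<le> card Y"
    then obtain S where "S \<subseteq> Y" "card S = 4" by (meson obtain_subset_with_card_n)
    then show "\<exists>S\<subseteq>Y. card S = 4 \<and> clique S E"
      using redR Y(1) by (meson Diff_subset smaller_clique subset_trans)
  qed (use finR in auto)
  moreover have "(w ` {..<s} \<union> ?Q) \<inter> (R - ?Q) = {}" using wR by auto
  ultimately have "packing E ((w ` {..<s} \<union> ?Q) \<union> (R - ?Q)) ({..<s} \<union> {s..<n}) (\<lambda>_. 4)"
    using packing_Un by fastforce
  moreover have "(w ` {..<s} \<union> ?Q) \<union> (R - ?Q) \<subseteq> X"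
  proof -
    have "w ` {..<s} \<subseteq> X" using wz(1) K(1) by blast
    moreover have "?Q \<subseteq> X" using T(1) RX by blast
    ultimately show ?thesis using RX by blast
  qed
  moreover have "{..<n} \<subseteq> {..<s} \<union> {s..<n}" by auto
  ultimately show False using no packing_mono by metis
qed

lemma packing_matching_singletons:
  assumes "packing F X {..<m} (\<lambda>_. 2)" "finite X" "J \<subseteq> {..<n}" "card J \<le> m" "n + card J \<le> card X"
  shows "packing F X {..<n} (\<lambda>i. if i \<in> J then 2 else 1)"
proof -
  have finJ: "finite J" using assms(3) finite_subset by blast
  have "packing F X J (\<lambda>_. 2)" using packing_reindex[OF assms(1) finJ] assms(4) by simp
  then have "packing F X J (\<lambda>i. if i \<in> J then 2 else 1)" by (rule packing_mono) auto
  then have "packing F X (J \<union> ({..<n} - J)) (\<lambda>i. if i \<in> J then 2 else 1)"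
    using assms finJ card_mono[OF _ assms(3)]
    by (intro packing_singletons) (auto simp: card_Diff_subset)
  moreover have "J \<union> ({..<n} - J) = {..<n}" using assms(3) by blast
  ultimately show ?thesis by simp
qed

lemma packing_some_singletons:
  assumes "finite X" "J \<subseteq> {..<n}" "card J \<le> card X"
  shows "packing F X {..<n} (\<lambda>i. if i \<in> J then 1 else 0)"
proof -
  have finJ: "finite J" using assms(2) finite_subset by blast
  have "packing F X ({} \<union> J) (\<lambda>i. if i \<in> J then 1 else 0)"
    using assms finJ by (intro packing_singletons) auto
  then have "packing F X (J \<union> ({..<n} - J)) (\<lambda>i. if i \<in> J then 1 else 0)"
    using assms finJ
    by (intro packing_extend[where t = 0 and q = 0]) (auto intro!: exI[of _ "{}"])
  moreover have "J \<union> ({..<n} - J) = {..<n}" using assms(2) by blast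
  ultimately show ?thesis by simp
qed

lemma blue_packing_three_parts:
  assumes fin: "finite A" "finite B" "finite C" "finite D"
    and no: "\<not> packing E A {..<n} (\<lambda>_. 4)" "\<not> packing E B {..<n} (\<lambda>_. 4)" "\<not> packing E C {..<n} (\<lambda>_. 4)"
    and large: "n \<le> card A" "n \<le> card B" "n \<le> card C"
    and disj: "A \<inter> (B \<union> (C \<union> D)) = {}" "B \<inter> (C \<union> D) = {}" "C \<inter> D = {}"
    and blue: "\<And>x y. x \<in> A \<Longrightarrow> y \<in> B \<union> (C \<union> D) \<Longrightarrow> {x, y} \<in> - E"
      "\<And>x y. x \<in> B \<Longrightarrow> y \<in> C \<union> D \<Longrightarrow> {x, y} \<in> - E" "\<And>x y. x \<in> C \<Longrightarrow> y \<in> D \<Longrightarrow> {x, y} \<in> - E"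
    and card: "13 * n \<le> card A + card B + card C + card D + 3"
  shows "packing (- E) (A \<union> (B \<union> (C \<union> D))) {..<n} (\<lambda>_. 4)"
proof -
  define a where "a = min n (card A + 1 - 4 * n)"
  define b where "b = min (card B + 1 - 4 * n) (n - a)"
  define c where "c = min (card C + 1 - 4 * n) (n - a - b)"
  have a: "packing (- E) A {..<a} (\<lambda>_. 2)"
    using a_def by (cases "a = 0") (auto intro!: blue_matching[OF fin(1) no(1)])
  have b: "packing (- E) B {..<b} (\<lambda>_. 2)"
    using b_def by (cases "b = 0") (auto intro!: blue_matching[OF fin(2) no(2)])
  have c: "packing (- E) C {..<c} (\<lambda>_. 2)"
    using c_def by (cases "c = 0") (auto intro!: blue_matching[OF fin(3) no(3)])
  have le: "a + b + c \<le> n" using a_def b_def c_def by linarith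
  have d: "n - (a + b + c) \<le> card D" using a_def b_def c_def card by linarith
  let ?IA = "{..<a}" and ?IB = "{a..<a + b}" and ?IC = "{a + b..<a + b + c}" and ?ID = "{a + b + c..<n}"
  have "packing (- E) A {..<n} (\<lambda>i. if i \<in> ?IA then 2 else 1)"
    using fin a le large a_def by (intro packing_matching_singletons[OF a]) auto
  moreover have "packing (- E) B {..<n} (\<lambda>i. if i \<in> ?IB then 2 else 1)"
    using fin b le large b_def by (intro packing_matching_singletons[OF b]) auto
  moreover have "packing (- E) C {..<n} (\<lambda>i. if i \<in> ?IC then 2 else 1)"
    using fin c le large c_def by (intro packing_matching_singletons[OF c]) auto
  moreover have "packing (- E) D {..<n} (\<lambda>i. if i \<in> ?ID then 1 else 0)"
    using fin d by (intro packing_some_singletons) auto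
  ultimately have "packing (- E) (A \<union> (B \<union> (C \<union> D))) {..<n}
     (\<lambda>i. (if i \<in> ?IA then 2 else 1) + ((if i \<in> ?IB then 2 else 1) +
       ((if i \<in> ?IC then 2 else 1) + (if i \<in> ?ID then 1 else 0))))"
    using fin disj blue by (intro packing_join) simp_all
  then show ?thesis by (rule packing_mono) auto
qed

definition closed_part :: "'a set set \<Rightarrow> 'a set \<Rightarrow> 'a set \<Rightarrow> bool" where
  "closed_part E V S \<longleftrightarrow> S \<subseteq> V \<and> (\<forall>x\<in>S. \<forall>y\<in>V - S. {x, y} \<notin> E)"

lemma closed_part_Diff:
  "closed_part E V S \<Longrightarrow> closed_part E V T \<Longrightarrow> closed_part E V (S - T)"
  unfolding closed_part_def by (metis Diff_iff insert_commute subset_eq)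

lemma blue_packing_two_parts:
  assumes finV: "finite V" and n: "2 \<le> n" and card: "13 * n = card V + 3"
    and clA: "closed_part E V A" and clB: "closed_part E V B" and disj: "A \<inter> B = {}"
    and noA: "\<not> packing E A {..<n} (\<lambda>_. 4)" and noB: "\<not> packing E B {..<n} (\<lambda>_. 4)"
    and rest: "card (V - A - B) < n" and neq: "A \<noteq> V" and B: "card B + 2 \<le> 5 * n"
  shows "packing (- E) V {..<n} (\<lambda>_. 4)"
proof -
  define W where "W = V - A"
  have AV: "A \<subseteq> V" and BV: "B \<subseteq> V" using clA clB by (auto simp: closed_part_def)
  have fA: "finite A" and fB: "finite B" and fW: "finite W" and BW: "B \<subseteq> W"
    using finV AV BV disj finite_subset unfolding W_def by auto
  have cV: "card V = card A + card W"
    unfolding W_def using finV AV fA by (simp add: card_Diff_subset card_mono)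
  have cW: "card W = card B + card (V - A - B)"
    unfolding W_def using fW BW fB by (simp add: card_Diff_subset card_mono W_def)
  have W0: "0 < card W" using neq AV fW unfolding W_def by (auto simp: card_gt_0_iff)
  have AW: "{x, y} \<in> - E" if "x \<in> A" "y \<in> W" for x y
    using clA that unfolding closed_part_def W_def by auto
  have join: ?thesis if "packing (- E) A {..<n} f" "packing (- E) W {..<n} g"
    "\<And>i. i < n \<Longrightarrow> f i + g i = 4" for f g
  proof -
    have "packing (- E) (A \<union> W) {..<n} (\<lambda>i. f i + g i)"
      using that fA fW AW by (intro packing_join) (auto simp: W_def)
    then show ?thesis by (rule packing_mono) (use AV that in \<open>auto simp: W_def\<close>)
  qed
  have n0: "0 < n" using n by simp
  obtain Y where Y: "Y \<subseteq> A" "card A \<le> card Y + 4 * (n - 1)" "\<not> (\<exists>S\<subseteq>Y. card S = 4 \<and> clique S E)"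
    using obtain_clique_free_rest[OF noA fA n0] by blast
  have fY: "finite Y" using Y(1) fA finite_subset by blast
  have YA: "packing (- E) A {..<n} f" if "packing (- E) Y {..<n} f" for f
    using packing_mono[OF that Y(1) order_refl] by simp
  have arrows_4_2: "arrows E 4 4 2" using arrows_Compl[OF arrows_edge[of "- E" 4]] by simp
  consider "card W < n" | "n \<le> card W" "7 * n + 2 \<le> card A" | "n \<le> card W" "card A < 7 * n + 2"
    by linarith
  then show ?thesis
  proof cases
    case 1
    let ?f = "\<lambda>i. if i < card W then 3 else 4 :: nat"
    have "packing (- E) Y ({} \<union> {card W..<n}) ?f"
      using 1 fY Y(2) cV card W0 n
      by (intro packing_extend_free[OF arrows_4_4 Y(3)]) auto
    then have "packing (- E) Y ({card W..<n} \<union> {..<card W}) ?f"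
      using 1 fY Y(2) cV card W0 n
      by (intro packing_extend_free[OF arrows_4_3 Y(3)]) auto
    moreover have "{card W..<n} \<union> {..<card W} = {..<n}" using 1 by auto
    ultimately have "packing (- E) A {..<n} ?f" using YA by simp
    moreover have "packing (- E) W {..<n} (\<lambda>i. if i \<in> {..<card W} then 1 else 0)"
      using 1 fW by (intro packing_some_singletons) auto
    ultimately show ?thesis by (rule join) auto
  next
    case 2
    have "packing (- E) Y ({} \<union> {..<n}) (\<lambda>_. 3)"
      using 2 fY Y(2) n by (intro packing_extend_free[OF arrows_4_3 Y(3)]) auto
    moreover have "packing (- E) W {..<n} (\<lambda>i. if i \<in> {..<n} then 1 else 0)"
      using 2 fW by (intro packing_some_singletons) auto
    ultimately show ?thesis
      using YA by (intro join[where f = "\<lambda>_. 3" and g = "\<lambda>i. if i \<in> {..<n} then 1 else 0"]) auto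
  next
    case 3
    let ?f = "\<lambda>i. if i < n - 1 then 3 else 2 :: nat"
    have A7: "7 * n \<le> card A" using cV cW card rest B by linarith
    have "packing (- E) Y ({} \<union> {..<n - 1}) ?f"
      using A7 fY Y(2) n by (intro packing_extend_free[OF arrows_4_3 Y(3)]) auto
    then have "packing (- E) Y ({..<n - 1} \<union> {n - 1}) ?f"
      using A7 fY Y(2) n by (intro packing_extend_free[OF arrows_4_2 Y(3)]) auto
    moreover have "{..<n - 1} \<union> {n - 1} = {..<n}" using n by auto
    ultimately have fA: "packing (- E) A {..<n} ?f" using YA by simp
    have W6: "6 * n \<le> card W + 4" using 3(2) cV card by linarith
    have "packing (- E) W {..<1} (\<lambda>_. 2)"
    proof (cases "V - A - B = {}")
      case True
      then have "card B = card W" using cW by (metis add.right_neutral card.empty)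
      then have "packing (- E) B {..<1} (\<lambda>_. 2)"
        using W6 n by (intro blue_matching[OF fB noB]) auto
      then show ?thesis using BW by (rule packing_mono) auto
    next
      case False
      then obtain d where d: "d \<in> V - A - B" by blast
      have "B \<noteq> {}" using W6 n cW rest by auto
      then obtain x where x: "x \<in> B" by blast
      have "{x, d} \<in> - E" using x d clB by (auto simp: closed_part_def)
      moreover have "x \<noteq> d" "x \<in> W" "d \<in> W" using x d BW by (auto simp: W_def)
      ultimately show ?thesis
        unfolding packing_def
        by (intro exI[of _ "\<lambda>_. {x, d}"]) (auto simp: clique_doubleton disjoint_family_on_def)
    qed
    then have "packing (- E) W {..<n} (\<lambda>i. if i \<in> {n - 1} then 2 else 1)"
      using n fW W6 by (intro packing_matching_singletons) auto
    with fA show ?thesis by (rule join) (use n in auto)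
  qed
qed

lemma blue_packing:
  fixes comp :: "'a \<Rightarrow> 'a set"
  assumes finV: "finite V" and n: "2 \<le> n" and card: "13 * n = card V + 3"
    and redV: "packing E V {..<n} (\<lambda>_. 4)"
    and comp: "\<And>x. x \<in> V \<Longrightarrow> x \<in> comp x" "\<And>x. x \<in> V \<Longrightarrow> closed_part E V (comp x)"
      "\<And>S x. closed_part E V S \<Longrightarrow> x \<in> S \<Longrightarrow> comp x \<subseteq> S"
    and no: "\<And>x. x \<in> V \<Longrightarrow> \<not> packing E (comp x) {..<n} (\<lambda>_. 4)"
  shows "packing (- E) V {..<n} (\<lambda>_. 4)"
proof -
  define good where "good S \<longleftrightarrow> closed_part E V S \<and> \<not> packing E S {..<n} (\<lambda>_. 4)" for S
  have finS: "finite S" "S \<subseteq> V" "card S \<le> card V" if "closed_part E V S" for S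
    using that finV finite_subset card_mono unfolding closed_part_def by blast+
  have small: "good S" if "closed_part E V S" "card S < 4 * n" for S
    using that not_packing_small[OF finS(1)] good_def by simp
  have good0: "good {}" using n by (intro small) (auto simp: closed_part_def)
  have le: "card S \<le> card V" if "good S" for S using that finS(3) good_def by simp
  obtain A where A: "good A" "\<And>S. good S \<Longrightarrow> card S \<le> card A"
    using ex_has_greatest_nat[of good "{}" card "Suc (card V)"] good0 le by (auto simp: less_Suc_eq_le)
  obtain B where B: "good B" "B \<subseteq> V - A" "\<And>S. good S \<Longrightarrow> S \<subseteq> V - A \<Longrightarrow> card S \<le> card B"
    using ex_has_greatest_nat[of "\<lambda>S. good S \<and> S \<subseteq> V - A" "{}" card "Suc (card V)"] good0 le
    by (auto simp: less_Suc_eq_le)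
  have clA: "closed_part E V A" and noA: "\<not> packing E A {..<n} (\<lambda>_. 4)"
    and clB: "closed_part E V B" and noB: "\<not> packing E B {..<n} (\<lambda>_. 4)"
    using A(1) B(1) good_def by auto
  have disj: "A \<inter> B = {}" using B(2) by blast
  let ?D = "V - A - B"
  have AV: "A \<subseteq> V" and BV: "B \<subseteq> V" using clA clB finS by auto
  have fA: "finite A" and fB: "finite B" using finS clA clB by auto
  have cV: "card V = card A + card B + card ?D"
  proof -
    have "card (V - A) = card B + card ?D"
      using B(2) fB finV by (simp add: card_Diff_subset card_mono)
    moreover have "card V = card A + card (V - A)"
      using AV fA finV by (simp add: card_Diff_subset card_mono)
    ultimately show ?thesis by simp
  qed
  show ?thesis
  proof (cases "card ?D < n")
    case False
    have "closed_part E V V" by (simp add: closed_part_def)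
    then have clD: "closed_part E V ?D" using clA clB closed_part_Diff by blast
    obtain C where C: "closed_part E V C" "C \<subseteq> ?D" "n \<le> card C"
      and minC: "\<And>S. closed_part E V S \<Longrightarrow> S \<subseteq> ?D \<Longrightarrow> n \<le> card S \<Longrightarrow> card C \<le> card S"
      using ex_has_least_nat[of "\<lambda>S. closed_part E V S \<and> S \<subseteq> ?D \<and> n \<le> card S" ?D card] clD False
      by auto
    have fC: "finite C" using finS C by blast
    have goodC: "good C"
    proof -
      have "C \<noteq> {}" using C(3) n by auto
      then obtain x where x: "x \<in> C" by blast
      then have xV: "x \<in> V" using C(2) by blast
      have sub: "comp x \<subseteq> C" using comp(3)[OF C(1) x] .
      show ?thesis
      proof (cases "comp x = C")
        case True
        then show ?thesis using no[OF xV] C(1) good_def by simp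
      next
        case False
        have fx: "finite (comp x)" using sub fC finite_subset by blast
        have "card (comp x) < card C" using sub False fC by (simp add: psubset_card_mono psubset_eq)
        then have "card (comp x) < n"
          using minC[OF comp(2)[OF xV]] sub C(2) by force
        moreover have "card (C - comp x) < card C"
          using comp(1)[OF xV] x fC by (intro psubset_card_mono) auto
        then have "card (C - comp x) < n"
          using minC[OF closed_part_Diff[OF C(1) comp(2)[OF xV]]] C(2) by force
        moreover have "card C = card (comp x) + card (C - comp x)"
          using sub fx fC by (simp add: card_Diff_subset card_mono)
        ultimately show ?thesis using C(1) by (intro small) auto
      qed
    qed
    then have noC: "\<not> packing E C {..<n} (\<lambda>_. 4)" using good_def by simp
    have BC: "card C \<le> card B" using B(3)[OF goodC] C(2) by blast
    have AC: "card C \<le> card A" using A(2)[OF goodC] .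
    have fD: "finite (?D - C)" using finV by simp
    have cD: "card ?D = card C + card (?D - C)"
      using C(2) fC finV by (simp add: card_Diff_subset card_mono)
    have "packing (- E) (A \<union> (B \<union> (C \<union> (?D - C)))) {..<n} (\<lambda>_. 4)"
    proof (rule blue_packing_three_parts[OF fA fB fC fD noA noB noC])
      show "13 * n \<le> card A + card B + card C + card (?D - C) + 3" using card cV cD by linarith
      show "A \<inter> (B \<union> (C \<union> (?D - C))) = {}" "B \<inter> (C \<union> (?D - C)) = {}" "C \<inter> (?D - C) = {}"
        using disj C(2) by blast+
      show "{x, y} \<in> - E" if "x \<in> A" "y \<in> B \<union> (C \<union> (?D - C))" for x y
        using that clA disj BV C(2) unfolding closed_part_def by blast
      show "{x, y} \<in> - E" if "x \<in> B" "y \<in> C \<union> (?D - C)" for x y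
        using that clB C(2) unfolding closed_part_def by blast
      show "{x, y} \<in> - E" if "x \<in> C" "y \<in> ?D - C" for x y
        using that C(1) unfolding closed_part_def by blast
    qed (use AC BC C(3) in auto)
    then show ?thesis by (rule packing_mono) (use AV BV C(2) in auto)
  next
    case True
    have neq: "A \<noteq> V" "B \<noteq> V" using redV noA noB by auto
    have D': "V - B - A = ?D" by blast
    consider "5 * n \<le> card A + 1" "5 * n \<le> card B + 1" | "card B + 2 \<le> 5 * n" | "card A + 2 \<le> 5 * n"
      by linarith
    then show ?thesis
    proof cases
      case 1
      have "packing (- E) (A \<union> B) {..<n} (\<lambda>i. 2 + 2)"
      proof (rule packing_join)
        show "packing (- E) A {..<n} (\<lambda>_. 2)" "packing (- E) B {..<n} (\<lambda>_. 2)"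
          using 1 by (auto intro!: blue_matching[OF fA noA] blue_matching[OF fB noB])
        show "{x, y} \<in> - E" if "x \<in> A" "y \<in> B" for x y
          using that clA disj BV unfolding closed_part_def by blast
      qed (use fA fB disj in auto)
      then show ?thesis by (rule packing_mono) (use AV BV in auto)
    next
      case 2
      then show ?thesis
        using blue_packing_two_parts[OF finV n card clA clB disj noA noB True neq(1)] by simp
    next
      case 3
      then show ?thesis
        using blue_packing_two_parts[OF finV n card clB clA _ noB noA _ neq(2)] True disj D'
        by (simp add: Int_commute)
    qed
  qed
qed

subsection \<open>Connected packings\<close>

definition connected_in :: "'a set set \<Rightarrow> 'a set \<Rightarrow> bool" where
  "connected_in E S \<longleftrightarrow> (\<forall>u\<in>S. \<forall>v\<in>S. (u, v) \<in> (adj \<lparr>verts = S, edges = {e \<in> [S]\<^bsup>2\<^esup>. e \<in> E}\<rparr>)\<^sup>*)"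

lemma adj_induced:
  "(u, v) \<in> adj \<lparr>verts = S, edges = {e \<in> [S]\<^bsup>2\<^esup>. e \<in> E}\<rparr> \<longleftrightarrow> u \<in> S \<and> v \<in> S \<and> u \<noteq> v \<and> {u, v} \<in> E"
  by (auto simp: adj_def)

lemma connected_in_complement:
  assumes "closed_part E V S" "S \<noteq> {}" "S \<noteq> V"
  shows "connected_in (- E) V"
proof -
  let ?R = "adj \<lparr>verts = V, edges = {e \<in> [V]\<^bsup>2\<^esup>. e \<in> - E}\<rparr>"
  have SV: "S \<subseteq> V" using assms(1) by (simp add: closed_part_def)
  obtain x y where x: "x \<in> S" and y: "y \<in> V - S" using assms SV by blast
  have cross: "(u, v) \<in> ?R" "(v, u) \<in> ?R" if "u \<in> S" "v \<in> V - S" for u v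
    using assms(1) SV that unfolding adj_induced closed_part_def by (auto simp: insert_commute)
  have toy: "(u, y) \<in> ?R\<^sup>*" "(y, u) \<in> ?R\<^sup>*" if "u \<in> V" for u
  proof -
    show "(u, y) \<in> ?R\<^sup>*"
      using cross[of u y] cross[of x u] cross[of x y] x y that
      by (cases "u \<in> S") (auto intro: r_into_rtrancl converse_rtrancl_into_rtrancl)
    show "(y, u) \<in> ?R\<^sup>*"
      using cross[of u y] cross[of x u] cross[of x y] x y that
      by (cases "u \<in> S") (auto intro: r_into_rtrancl converse_rtrancl_into_rtrancl)
  qed
  then show ?thesis unfolding connected_in_def by (meson rtrancl_trans)
qed

lemma connected_packing:
  assumes finV: "finite V" and n: "2 \<le> n" and card: "13 * n = card V + 3"
    and redV: "packing E V {..<n} (\<lambda>_. 4)"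
  shows "(\<exists>S\<subseteq>V. connected_in E S \<and> packing E S {..<n} (\<lambda>_. 4)) \<or>
    connected_in (- E) V \<and> packing (- E) V {..<n} (\<lambda>_. 4)"
proof -
  define R where "R = adj \<lparr>verts = V, edges = {e \<in> [V]\<^bsup>2\<^esup>. e \<in> E}\<rparr>"
  define comp where "comp x = {y. (x, y) \<in> R\<^sup>*}" for x
  have R: "(u, v) \<in> R \<longleftrightarrow> u \<in> V \<and> v \<in> V \<and> u \<noteq> v \<and> {u, v} \<in> E" for u v
    unfolding R_def adj_induced ..
  have compV: "comp x \<subseteq> V" if "x \<in> V" for x
  proof
    fix y assume "y \<in> comp x"
    then have "(x, y) \<in> R\<^sup>*" by (simp add: comp_def)
    then show "y \<in> V" using that by induction (auto simp: R)
  qed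
  have self: "x \<in> comp x" for x by (simp add: comp_def)
  have closed: "closed_part E V (comp x)" if x: "x \<in> V" for x
    unfolding closed_part_def
  proof (intro conjI ballI notI)
    fix y z assume y: "y \<in> comp x" and z: "z \<in> V - comp x" and "{y, z} \<in> E"
    then have "(y, z) \<in> R" using compV[OF x] by (auto simp: R)
    then show False using y z by (auto simp: comp_def intro: rtrancl_into_rtrancl)
  qed (use compV[OF x] in auto)
  have least: "comp x \<subseteq> S" if S: "closed_part E V S" "x \<in> S" for S x
  proof
    fix y assume "y \<in> comp x"
    then have "(x, y) \<in> R\<^sup>*" by (simp add: comp_def)
    then show "y \<in> S"
    proof induction
      case base
      then show ?case using S by simp
    next
      case (step y z)
      then show ?case using S(1) unfolding closed_part_def R by blast
    qed
  qed
  have conn: "connected_in E (comp x)" for x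
  proof -
    let ?Q = "adj \<lparr>verts = comp x, edges = {e \<in> [comp x]\<^bsup>2\<^esup>. e \<in> E}\<rparr>"
    have from_x: "(x, y) \<in> ?Q\<^sup>*" if "y \<in> comp x" for y
    proof -
      have "(x, y) \<in> R\<^sup>*" using that by (simp add: comp_def)
      then show ?thesis
      proof induction
        case (step y z)
        then have "y \<in> comp x" "z \<in> comp x"
          by (auto simp: comp_def intro: rtrancl_into_rtrancl)
        then have "(y, z) \<in> ?Q" using step(2) unfolding adj_induced R by blast
        then show ?case using step.IH by (rule rtrancl_into_rtrancl[rotated])
      qed simp
    qed
    have "sym ?Q" unfolding sym_def adj_induced by (auto simp: insert_commute)
    then have "sym (?Q\<^sup>*)" by (rule sym_rtrancl)
    then show ?thesis using from_x unfolding connected_in_def by (meson rtrancl_trans symD)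
  qed
  show ?thesis
  proof (cases "\<exists>x\<in>V. packing E (comp x) {..<n} (\<lambda>_. 4)")
    case True
    then show ?thesis using conn compV by blast
  next
    case False
    then have no: "\<And>x. x \<in> V \<Longrightarrow> \<not> packing E (comp x) {..<n} (\<lambda>_. 4)" by blast
    have "packing (- E) V {..<n} (\<lambda>_. 4)"
      by (rule blue_packing[OF finV n card redV, of comp]) (use self closed least no in auto)
    moreover have "V \<noteq> {}" using card n by auto
    then obtain x where x: "x \<in> V" by blast
    have "comp x \<noteq> V" using no[OF x] redV by auto
    then have "connected_in (- E) V"
      using connected_in_complement[OF closed[OF x]] self[of x] by blast
    ultimately show ?thesis by blast
  qed
qed

subsection \<open>Copies of disjoint complete graphs as packings\<close>

lemma contains_copy_iff:
  "contains_copy G H \<longleftrightarrow>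
    (\<exists>f. inj_on f (verts H) \<and> f ` verts H \<subseteq> verts G \<and> (\<forall>e\<in>edges H. f ` e \<in> edges G))"
  by (simp add: contains_copy_def subgraph_def relabel_def image_subset_iff)

lemma contains_copy_copies_iff:
  assumes "0 < k"
  shows "contains_copy G (copies n (complete_graph k)) \<longleftrightarrow> packing (edges G) (verts G) {..<n} (\<lambda>_. k)"
    (is "?L \<longleftrightarrow> ?R")
proof
  assume ?L
  then obtain f where f: "inj_on f ({..<n} \<times> {..<k})" "f ` ({..<n} \<times> {..<k}) \<subseteq> verts G"
    and fe: "\<And>i e. i < n \<Longrightarrow> e \<in> [{..<k}]\<^bsup>2\<^esup> \<Longrightarrow> f ` (Pair i ` e) \<in> edges G"
    unfolding contains_copy_iff by (auto simp: copies_def complete_graph_def)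
  show ?R
    unfolding packing_def
  proof (intro exI[of _ "\<lambda>i. f ` ({i} \<times> {..<k})"] conjI ballI)
    fix i assume "i \<in> {..<n}"
    then have i: "i < n" by simp
    then show "f ` ({i} \<times> {..<k}) \<subseteq> verts G" using f(2) by auto
    have "inj_on f ({i} \<times> {..<k})" using f(1) by (rule inj_on_subset) (use i in auto)
    then show "card (f ` ({i} \<times> {..<k})) = k" by (simp add: card_image card_cartesian_product)
    show "clique (f ` ({i} \<times> {..<k})) (edges G)"
      unfolding clique_def
    proof (intro ballI impI)
      fix v w assume vw: "v \<in> f ` ({i} \<times> {..<k})" "w \<in> f ` ({i} \<times> {..<k})" "v \<noteq> w"
      then obtain a b where ab: "v = f (i, a)" "w = f (i, b)" "a < k" "b < k" by auto
      then have "{a, b} \<in> [{..<k}]\<^bsup>2\<^esup>" using vw(3) by auto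
      then show "{v, w} \<in> edges G" using fe[OF i] ab by fastforce
    qed
  next
    show "disjoint_family_on (\<lambda>i. f ` ({i} \<times> {..<k})) {..<n}"
      unfolding disjoint_family_on_def using f(1) by (auto dest: inj_onD)
  qed
next
  assume ?R
  then obtain K where K: "\<And>i. i < n \<Longrightarrow> K i \<subseteq> verts G \<and> card (K i) = k \<and> clique (K i) (edges G)"
    "disjoint_family_on K {..<n}"
    unfolding packing_def by auto
  have "\<exists>h. inj_on h {..<k} \<and> h ` {..<k} \<subseteq> K i" if i: "i < n" for i
  proof -
    have "finite (K i)" using K(1)[OF i] assms card_ge_0_finite by force
    then show ?thesis using card_le_inj[of "{..<k}" "K i"] K(1)[OF i] by auto
  qed
  then obtain h where h: "\<And>i. i < n \<Longrightarrow> inj_on (h i) {..<k}" "\<And>i. i < n \<Longrightarrow> h i ` {..<k} \<subseteq> K i"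
    by metis
  let ?f = "\<lambda>(i, j). h i j"
  have "inj_on ?f ({..<n} \<times> {..<k})"
  proof (rule inj_onI, clarsimp)
    fix i a j b assume *: "i < n" "a < k" "j < n" "b < k" "h i a = h j b"
    have "h i a \<in> K i" "h j b \<in> K j" using h(2)[of i] h(2)[of j] * by auto
    then have "i = j" using * disjoint_family_onD[OF K(2), of i j] by auto
    then show "i = j \<and> a = b" using * h(1)[of i] by (auto dest: inj_onD)
  qed
  moreover have "?f ` ({..<n} \<times> {..<k}) \<subseteq> verts G" using h(2) K(1) by fastforce
  moreover have "?f ` (Pair i ` e) \<in> edges G" if i: "i < n" and e: "e \<in> [{..<k}]\<^bsup>2\<^esup>" for i e
  proof -
    obtain a b where ab: "e = {a, b}" "a < k" "b < k" "a \<noteq> b"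
      using e by (metis lessThan_iff nsets2_E)
    have "h i a \<in> K i" "h i b \<in> K i" "h i a \<noteq> h i b"
      using h[OF i] ab by (auto dest: inj_onD)
    then show ?thesis using K(1)[OF i] ab(1) by (auto simp: clique_def)
  qed
  ultimately show ?L
    unfolding contains_copy_iff copies_def complete_graph_def
    by (intro exI[of _ ?f]) auto
qed

lemma contains_copy_trans:
  assumes "contains_copy G H" "contains_copy H K"
  shows "contains_copy G K"
proof -
  obtain f g where f: "inj_on f (verts H)" "f ` verts H \<subseteq> verts G" "\<And>e. e \<in> edges H \<Longrightarrow> f ` e \<in> edges G"
    and g: "inj_on g (verts K)" "g ` verts K \<subseteq> verts H" "\<And>e. e \<in> edges K \<Longrightarrow> g ` e \<in> edges H"
    using assms unfolding contains_copy_iff by auto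
  have "inj_on (f \<circ> g) (verts K)" using f(1) g(1,2) by (meson comp_inj_on inj_on_subset)
  moreover have "(f \<circ> g) ` e \<in> edges G" if "e \<in> edges K" for e
    using f(3)[OF g(3)[OF that]] by (simp add: image_comp)
  ultimately show ?thesis
    using f(2) g(2) unfolding contains_copy_iff
    by (intro exI[of _ "f \<circ> g"]) fastforce
qed

lemma packing_edges_mono:
  assumes "packing E X I f" "\<And>e. e \<in> [X]\<^bsup>2\<^esup> \<Longrightarrow> e \<in> E \<Longrightarrow> e \<in> F"
  shows "packing F X I f"
  using assms unfolding packing_def clique_def by (smt (verit) doubleton_in_nsets_2 subset_eq)

lemma verts_color_class [simp]: "verts (color_class (complete_graph N) c i) = {..<N}"
  by (simp add: color_class_def complete_graph_def)

lemma packing_color_class_iff: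
  "packing (edges (color_class (complete_graph N) c i)) {..<N} I f \<longleftrightarrow> packing {e. c e = i} {..<N} I f"
  unfolding color_class_def complete_graph_def by (auto elim!: packing_edges_mono)

lemma packing_second_color_iff:
  assumes "edge_coloring 2 (complete_graph N) c" "S \<subseteq> {..<N}"
  shows "packing {e. c e = 1} S I f \<longleftrightarrow> packing (- {e. c e = 0}) S I f"
proof -
  have "c e < 2" if "e \<in> [S]\<^bsup>2\<^esup>" for e
    using assms that nsets_mono[OF assms(2)] by (auto simp: edge_coloring_def complete_graph_def)
  then have "c e = 1 \<longleftrightarrow> c e \<noteq> 0" if "e \<in> [S]\<^bsup>2\<^esup>" for e
    using that by fastforce
  then show ?thesis by (auto elim!: packing_edges_mono)
qed

lemma mono_copy_copies_iff:
  assumes "edge_coloring 2 (complete_graph N) c" "0 < k"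
  shows "mono_copy 2 (complete_graph N) c (copies n (complete_graph k)) \<longleftrightarrow>
    packing {e. c e = 0} {..<N} {..<n} (\<lambda>_. k) \<or> packing (- {e. c e = 0}) {..<N} {..<n} (\<lambda>_. k)"
  unfolding mono_copy_def contains_copy_copies_iff[OF assms(2)] verts_color_class
    packing_color_class_iff packing_second_color_iff[OF assms(1) order_refl, symmetric]
  by (auto simp: less_2_cases_iff)

lemma mono_connected_supergraph:
  assumes "S \<subseteq> {..<N}" "connected_in {e. c e = i} S" "packing {e. c e = i} S {..<n} (\<lambda>_. k)"
    and "0 < n" "0 < k" "i < r"
  shows "\<exists>H\<in>connected_supergraphs (copies n (complete_graph k)). mono_copy r (complete_graph N) c H"
proof
  let ?H = "\<lparr>verts = S, edges = {e \<in> [S]\<^bsup>2\<^esup>. e \<in> {e. c e = i}}\<rparr>"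
  have "finite S" using assms(1) finite_subset by blast
  moreover have "S \<noteq> {}"
  proof
    assume "S = {}"
    then show False using assms(3-5) not_packing_small[of S k n] by simp
  qed
  moreover have "packing (edges ?H) (verts ?H) {..<n} (\<lambda>_. k)"
    using packing_edges_mono[OF assms(3)] by simp
  ultimately show "?H \<in> connected_supergraphs (copies n (complete_graph k))"
    using assms(2) contains_copy_copies_iff[OF assms(5), of ?H n]
    by (auto simp: connected_supergraphs_def simple_graph_def connected_graph_def connected_in_def)
  have "subgraph (relabel id ?H) (color_class (complete_graph N) c i)"
    using assms(1) nsets_mono[OF assms(1)]
    by (auto simp: subgraph_def relabel_def color_class_def complete_graph_def)
  then show "mono_copy r (complete_graph N) c ?H"
    unfolding mono_copy_def contains_copy_def
    by (intro exI[of _ i] exI[of _ id] conjI assms(6)) simp_all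
qed

lemma connected_ramsey:
  assumes c: "edge_coloring 2 (complete_graph N) c" and n: "2 \<le> n" and N: "13 * n = N + 3"
    and pack: "packing {e. c e = 0} {..<N} {..<n} (\<lambda>_. 4) \<or> packing (- {e. c e = 0}) {..<N} {..<n} (\<lambda>_. 4)"
  shows "\<exists>H\<in>connected_supergraphs (copies n (complete_graph 4)). mono_copy 2 (complete_graph N) c H"
proof -
  let ?E = "{e. c e = 0}"
  have "\<exists>S\<subseteq>{..<N}. connected_in ?E S \<and> packing ?E S {..<n} (\<lambda>_. 4) \<or>
      connected_in (- ?E) S \<and> packing (- ?E) S {..<n} (\<lambda>_. 4)"
    using pack
  proof
    assume "packing ?E {..<N} {..<n} (\<lambda>_. 4)"
    from connected_packing[OF _ n _ this] show ?thesis using N by auto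
  next
    assume "packing (- ?E) {..<N} {..<n} (\<lambda>_. 4)"
    from connected_packing[OF _ n _ this] show ?thesis unfolding double_complement using N by auto
  qed
  then obtain S where S: "S \<subseteq> {..<N}"
    and "connected_in ?E S \<and> packing ?E S {..<n} (\<lambda>_. 4) \<or>
      connected_in (- ?E) S \<and> packing (- ?E) S {..<n} (\<lambda>_. 4)" by blast
  then consider "connected_in ?E S" "packing ?E S {..<n} (\<lambda>_. 4)"
    | "connected_in (- ?E) S" "packing (- ?E) S {..<n} (\<lambda>_. 4)" by blast
  then show ?thesis
  proof cases
    case 1
    then show ?thesis using mono_connected_supergraph[OF S, of c 0 n 4 2] n by simp
  next
    case 2
    have "c e < 2" if "e \<in> [S]\<^bsup>2\<^esup>" for e
      using c that nsets_mono[OF S] by (auto simp: edge_coloring_def complete_graph_def)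
    then have "{e \<in> [S]\<^bsup>2\<^esup>. e \<in> - ?E} = {e \<in> [S]\<^bsup>2\<^esup>. e \<in> {e. c e = 1}}"
      by fastforce
    then have "connected_in {e. c e = 1} S" using 2(1) unfolding connected_in_def by simp
    moreover have "packing {e. c e = 1} S {..<n} (\<lambda>_. 4)"
      using 2(2) packing_second_color_iff[OF c S] by blast
    ultimately show ?thesis using mono_connected_supergraph[OF S, of c 1 n 4 2] n by simp
  qed
qed

subsection \<open>The lower bound\<close>

text \<open>Three red cliques on \<open>4n - 1\<close> vertices and one on \<open>n - 1\<close> vertices, with blue edges between
  different cliques: every blue \<open>K\<^sub>4\<close> meets the last clique.\<close>

lemma connected_ramsey_lower:
  assumes n: "0 < n" and N: "N + 3 < 13 * n"
  shows "\<exists>c. edge_coloring 2 (complete_graph N) c \<and>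
    \<not> (\<exists>H\<in>connected_supergraphs (copies n (complete_graph 4)). mono_copy 2 (complete_graph N) c H)"
proof -
  define m where "m = 4 * n - 1"
  have m: "0 < m" "m < 4 * n" using n m_def by auto
  define c :: "nat set \<Rightarrow> nat" where "c e = (if \<exists>q. \<forall>v\<in>e. v div m = q then 0 else 1)" for e
  have c0: "c {u, v} = 0 \<longleftrightarrow> u div m = v div m" for u v by (auto simp: c_def)
  have "\<not> mono_copy 2 (complete_graph N) c H"
    if H: "H \<in> connected_supergraphs (copies n (complete_graph 4))" for H
  proof
    assume "mono_copy 2 (complete_graph N) c H"
    then obtain i where i: "i < 2" and copy: "contains_copy (color_class (complete_graph N) c i) H"
      by (auto simp: mono_copy_def)
    have conn: "connected_graph H" and HnK: "contains_copy H (copies n (complete_graph 4))"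
      and fH: "finite (verts H)"
      using H by (auto simp: connected_supergraphs_def simple_graph_def)
    consider "i = 0" | "i = 1" using i by linarith
    then show False
    proof cases
      case 1
      obtain f where f: "inj_on f (verts H)"
        and fe: "\<And>e. e \<in> edges H \<Longrightarrow> f ` e \<in> edges (color_class (complete_graph N) c 0)"
        using copy 1 unfolding contains_copy_iff by auto
      have step: "f u div m = f v div m" if "(u, v) \<in> (adj H)\<^sup>*" for u v
        using that
      proof induction
        case (step v w)
        then have "{v, w} \<in> edges H" by (simp add: adj_def)
        then have "c (f ` {v, w}) = 0" using fe[of "{v, w}"] by (simp add: color_class_def)
        then show ?case using step.IH c0 by simp
      qed simp
      obtain x where x: "x \<in> verts H" using conn by (auto simp: connected_graph_def)
      have "f ` verts H \<subseteq> {m * (f x div m)..<m * (f x div m) + m}"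
      proof
        fix z assume "z \<in> f ` verts H"
        then obtain v where v: "v \<in> verts H" "z = f v" by blast
        then have "z div m = f x div m" using step[of v x] conn x unfolding connected_graph_def by blast
        then have "z = m * (f x div m) + z mod m" by (metis mult_div_mod_eq)
        then show "z \<in> {m * (f x div m)..<m * (f x div m) + m}"
          using mod_less_divisor[OF m(1), of z] unfolding atLeastLessThan_iff by linarith
      qed
      from card_mono[OF _ this] have "card (f ` verts H) \<le> m" by simp
      then have "card (verts H) < 4 * n" using f m(2) by (simp add: card_image)
      then have "\<not> packing (edges H) (verts H) {..<n} (\<lambda>_. 4)" using not_packing_small[OF fH] by blast
      then show False using HnK by (simp add: contains_copy_copies_iff)
    next
      case 2
      have "packing (edges (color_class (complete_graph N) c 1)) {..<N} {..<n} (\<lambda>_. 4)"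
        using contains_copy_trans[OF copy HnK] 2 contains_copy_copies_iff[of 4]
        by (metis verts_color_class zero_less_numeral)
      then have "packing {e. c e = 1} {..<N} {..<n} (\<lambda>_. 4)" by (simp only: packing_color_class_iff)
      then obtain K where K: "\<And>i. i < n \<Longrightarrow> K i \<subseteq> {..<N} \<and> card (K i) = 4 \<and> clique (K i) {e. c e = 1}"
        "disjoint_family_on K {..<n}"
        unfolding packing_def by auto
      have div4: "v div m < 4" if "v < N" for v
      proof -
        have "v < 4 * m" using that N n m_def by linarith
        then show ?thesis using m(1) by (simp add: less_mult_imp_div_less)
      qed
      have "\<exists>v\<in>K i. v div m = 3" if i: "i < n" for i
      proof -
        have inj: "inj_on (\<lambda>v. v div m) (K i)"
        proof (rule inj_onI, rule ccontr)
          fix u v assume "u \<in> K i" "v \<in> K i" "u div m = v div m" "u \<noteq> v"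
          then show False using K(1)[OF i] c0[of u v] by (auto simp: clique_def)
        qed
        have "(\<lambda>v. v div m) ` K i \<subseteq> {..<4}" using K(1)[OF i] div4 by blast
        moreover have "card ((\<lambda>v. v div m) ` K i) = card {..<4::nat}"
          using inj K(1)[OF i] by (simp add: card_image)
        ultimately have "(\<lambda>v. v div m) ` K i = {..<4}" by (intro card_subset_eq) auto
        then have "3 \<in> (\<lambda>v. v div m) ` K i" by simp
        then show ?thesis by auto
      qed
      then obtain v where v: "\<And>i. i < n \<Longrightarrow> v i \<in> K i" "\<And>i. i < n \<Longrightarrow> v i div m = 3" by metis
      have "inj_on v {..<n}"
        using v(1) K(2) unfolding inj_on_def disjoint_family_on_def by (metis disjoint_iff lessThan_iff)
      moreover have "v ` {..<n} \<subseteq> {3 * m..<N}"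
      proof
        fix z assume "z \<in> v ` {..<n}"
        then obtain i where i: "i < n" "z = v i" by auto
        have "3 * m \<le> z" using v(2)[OF i(1)] i(2) by (metis div_times_less_eq_dividend)
        moreover have "z < N" using v(1)[OF i(1)] K(1)[OF i(1)] i(2) by auto
        ultimately show "z \<in> {3 * m..<N}" by simp
      qed
      ultimately have "card {..<n} \<le> card {3 * m..<N}" by (intro card_inj_on_le) auto
      then show False using N n m_def by simp
    qed
  qed
  moreover have "edge_coloring 2 (complete_graph N) c" by (simp add: edge_coloring_def c_def)
  ultimately show ?thesis by blast
qed

lemma connected_ramsey_number:
  assumes n: "2 \<le> n"
    and pack: "\<And>c. edge_coloring 2 (complete_graph (13 * n - 3)) c \<Longrightarrow>
      packing {e. c e = 0} {..<13 * n - 3} {..<n} (\<lambda>_. 4) \<or>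
      packing (- {e. c e = 0}) {..<13 * n - 3} {..<n} (\<lambda>_. 4)"
  shows "ramsey_number 2 (connected_supergraphs (copies n (complete_graph 4))) = 13 * n - 3"
  unfolding ramsey_number_def
proof (rule Least_equality)
  show "\<forall>c. edge_coloring 2 (complete_graph (13 * n - 3)) c \<longrightarrow>
    (\<exists>H\<in>connected_supergraphs (copies n (complete_graph 4)). mono_copy 2 (complete_graph (13 * n - 3)) c H)"
    using connected_ramsey[OF _ n _ pack] n by simp
next
  fix N
  assume N: "\<forall>c. edge_coloring 2 (complete_graph N) c \<longrightarrow>
    (\<exists>H\<in>connected_supergraphs (copies n (complete_graph 4)). mono_copy 2 (complete_graph N) c H)"
  show "13 * n - 3 \<le> N"
  proof (rule ccontr)
    assume "\<not> ?thesis"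
    then have "N + 3 < 13 * n" by simp
    from connected_ramsey_lower[OF _ this] show False using N n by auto
  qed
qed

lemma ramsey_2K4_packing:
  assumes le: "ramsey_number 2 {copies 2 (complete_graph 4)} \<le> N"
    and c: "edge_coloring 2 (complete_graph N) c"
  shows "packing {e. c e = 0} {..<N} {..<2} (\<lambda>_. 4) \<or> packing (- {e. c e = 0}) {..<N} {..<2} (\<lambda>_. 4)"
proof -
  let ?P = "\<lambda>M. \<forall>c. edge_coloring 2 (complete_graph M) c \<longrightarrow>
    (\<exists>H\<in>{copies 2 (complete_graph 4)}. mono_copy 2 (complete_graph M) c H)"
  have "?P 26"
    using mono_packing[of "{..<26::nat}" 2] by (auto simp: mono_copy_copies_iff)
  then have P: "?P (ramsey_number 2 {copies 2 (complete_graph 4)})"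
    unfolding ramsey_number_def by (rule LeastI)
  define M where "M = ramsey_number 2 {copies 2 (complete_graph 4)}"
  have MN: "{..<M} \<subseteq> {..<N}" using le M_def by auto
  have cM: "edge_coloring 2 (complete_graph M) c"
    using c nsets_mono[OF MN, of 2] by (auto simp: edge_coloring_def complete_graph_def)
  then have "packing {e. c e = 0} {..<M} {..<2} (\<lambda>_. 4) \<or> packing (- {e. c e = 0}) {..<M} {..<2} (\<lambda>_. 4)"
    using P mono_copy_copies_iff[OF cM, of 4 2] unfolding M_def[symmetric] by simp
  then show ?thesis using packing_mono[OF _ MN order_refl refl] by blast
qed

theorem theorem2p5:
  "(\<forall>n::nat. n \<ge> 3 \<longrightarrow>
      ramsey_number 2 (connected_supergraphs (copies n (complete_graph 4))) = 13 * n - 3) \<and>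
   (ramsey_number 2 {copies 2 (complete_graph 4)} \<le> 23 \<longrightarrow>
      ramsey_number 2 (connected_supergraphs (copies 2 (complete_graph 4))) = 23)"
proof (intro conjI allI impI)
  fix n :: nat
  assume "n \<ge> 3"
  then show "ramsey_number 2 (connected_supergraphs (copies n (complete_graph 4))) = 13 * n - 3"
    by (intro connected_ramsey_number mono_packing) auto
next
  assume "ramsey_number 2 {copies 2 (complete_graph 4)} \<le> 23"
  from ramsey_2K4_packing[OF this]
  show "ramsey_number 2 (connected_supergraphs (copies 2 (complete_graph 4))) = 23"
    using connected_ramsey_number[of 2] by simp
qed

end
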